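(* (i) If $X$ and $Y$ are subshifts (over finite alphabets), each satisfying left almost specification with a bounded mistake function, then their product $X\times Y$ satisfies left almost specification with a bounded mistake function. (ii) If $X$ is a subshift satisfying left almost specification with a bounded mistake function and $Z$ is a symbolic factor of $X$, then $Z$ satisfies left almost specification with a bounded mistake function.
   Context: Let $A$ be a finite alphabet. $A^{\mathbb Z}$ carries the product topology and the shift $(\sigma x)(m)=x(m+1)$. A subshift is a closed subset $X\subset A^{\mathbb Z}$ with $\sigma(X)=X$. Its language $\mathcal L(X)$ is the set of all finite words appearing in points of $X$; $|w|$ is the length of the word $w$. For words of equal length, $d_H(v,w)=|\{i: v(i)\neq w(i)\}|$ (Hamming distance). Left almost specification (LAS) with mistake function $g:\mathbb N\to[0,\infty)$: $g(n)/n\to 0$, and for any $w^{(1)},w^{(2)}\in\mathcal L(X)$ there is $\bar w^{(1)}\in\mathcal L(X)$ of length $|w^{(1)}|$ with $d_H(\bar w^{(1)},w^{(1)})\le g(|w^{(1)}|)$ and $\bar w^{(1)}w^{(2)}\in\mathcal L(X)$ (the distance condition is vacuous for the empty word). If $X\subset A^{\mathbb Z}$ and $Y\subset B^{\mathbb Z}$ are subshifts, $X\times Y$ is regarded as a subshift over the alphabet $A\times B$. A symbolic factor of $X$ is a subshift $Z$ over a finite alphabet for which there is a continuous surjection $\phi:X\to Z$ commuting with the shift. *)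

theory Defs
  imports "HOL-Analysis.Analysis"
begin

text \<open>An alphabet is a finite set \<open>A\<close>, bi-infinite sequences are functions on the integers,
  and the topology on the full shift is the product of the discrete topologies on \<open>A\<close>
  (so its carrier is the set of sequences with all values in \<open>A\<close>).\<close>

definition full_shift :: "'a set \<Rightarrow> (int \<Rightarrow> 'a) topology" where
  "full_shift A = product_topology (\<lambda>_. discrete_topology A) UNIV"

definition shift :: "(int \<Rightarrow> 'a) \<Rightarrow> int \<Rightarrow> 'a" where
  "shift x = (\<lambda>m. x (m + 1))"

definition subshift :: "'a set \<Rightarrow> (int \<Rightarrow> 'a) set \<Rightarrow> bool" where
  "subshift A X \<longleftrightarrow> finite A \<and> closedin (full_shift A) X \<and> shift ` X = X"

text \<open>The empty word belongs to the language as soon as \<open>X\<close> is nonempty;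
  the empty subshift is allowed and has empty language.\<close>

definition language :: "(int \<Rightarrow> 'a) set \<Rightarrow> 'a list set" where
  "language X = {w. \<exists>x\<in>X. \<exists>m::int. \<forall>k<length w. w ! k = x (m + int k)}"

text \<open>Only meaningful for words of equal length.\<close>

definition hamming_dist :: "'a list \<Rightarrow> 'a list \<Rightarrow> nat" where
  "hamming_dist v w = card {i. i < length v \<and> v ! i \<noteq> w ! i}"

text \<open>For the empty word the distance condition reads \<open>0 \<le> g 0\<close>, which holds
  because \<open>g\<close> is nonnegative.\<close>

definition left_almost_spec :: "(int \<Rightarrow> 'a) set \<Rightarrow> (nat \<Rightarrow> real) \<Rightarrow> bool" where
  "left_almost_spec X g \<longleftrightarrow>
     (\<forall>n. 0 \<le> g n) \<and> (\<lambda>n. g n / real n) \<longlonglongrightarrow> 0 \<and>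
     (\<forall>w1\<in>language X. \<forall>w2\<in>language X. \<exists>w1'\<in>language X.
        length w1' = length w1 \<and>
        real (hamming_dist w1' w1) \<le> g (length w1) \<and>
        w1' @ w2 \<in> language X)"

definition bounded_left_almost_spec :: "(int \<Rightarrow> 'a) set \<Rightarrow> bool" where
  "bounded_left_almost_spec X \<longleftrightarrow> (\<exists>g. left_almost_spec X g \<and> bounded (range g))"

text \<open>A pair of sequences is identified with a sequence of pairs.\<close>

definition product_shift ::
    "(int \<Rightarrow> 'a) set \<Rightarrow> (int \<Rightarrow> 'b) set \<Rightarrow> (int \<Rightarrow> 'a \<times> 'b) set" where
  "product_shift X Y = {z. fst \<circ> z \<in> X \<and> snd \<circ> z \<in> Y}"

definition symbolic_factor ::
    "'a set \<Rightarrow> (int \<Rightarrow> 'a) set \<Rightarrow> 'b set \<Rightarrow> (int \<Rightarrow> 'b) set \<Rightarrow> bool" where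
  "symbolic_factor A X B Z \<longleftrightarrow> subshift B Z \<and>
     (\<exists>\<phi>. continuous_map (subtopology (full_shift A) X) (subtopology (full_shift B) Z) \<phi> \<and>
          \<phi> ` X = Z \<and> (\<forall>x\<in>X. \<phi> (shift x) = shift (\<phi> x)))"

lemma continuous_map_full_shift_comp:
  assumes "f ` A \<subseteq> B"
  shows "continuous_map (full_shift A) (full_shift B) (\<lambda>x. f \<circ> x)"
proof -
  have "continuous_map (full_shift A) (discrete_topology B) (\<lambda>x. f (x i))" for i
  proof -
    have "continuous_map (full_shift A) (discrete_topology A) (\<lambda>x. x i)"
      unfolding full_shift_def by (rule continuous_map_product_projection) simp
    moreover have "continuous_map (discrete_topology A) (discrete_topology B) f"
      using assms by (auto simp: continuous_map_def)
    ultimately show ?thesis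
      using continuous_map_compose[of "full_shift A" "discrete_topology A" "\<lambda>x. x i" _ f]
      by (simp add: o_def)
  qed
  then show ?thesis
    unfolding full_shift_def[of B] continuous_map_componentwise_UNIV by simp
qed

lemma comp_shift: "f \<circ> shift z = shift (f \<circ> z)"
  by (auto simp: shift_def)

lemma subshift_shift_iff:
  assumes "subshift A X"
  shows "shift x \<in> X \<longleftrightarrow> x \<in> X"
proof
  assume "shift x \<in> X"
  then obtain y where y: "y \<in> X" "shift x = shift y"
    using assms unfolding subshift_def by (metis imageE)
  have "x m = y m" for m
    using fun_cong[OF y(2), of "m - 1"] by (simp add: shift_def)
  then have "x = y" by auto
  then show "x \<in> X" using y by simp
qed (use assms in \<open>auto simp: subshift_def\<close>)

lemma subshift_product_shift:
  assumes X: "subshift A X" and Y: "subshift B Y"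
  shows "subshift (A \<times> B) (product_shift X Y)"
proof -
  have sub: "X \<subseteq> topspace (full_shift A)" "Y \<subseteq> topspace (full_shift B)"
    using X Y by (auto simp: subshift_def dest: closedin_subset)
  have eq: "product_shift X Y =
      {z \<in> topspace (full_shift (A \<times> B)). fst \<circ> z \<in> X} \<inter>
      {z \<in> topspace (full_shift (A \<times> B)). snd \<circ> z \<in> Y}"
    using sub by (fastforce simp: product_shift_def full_shift_def PiE_iff mem_Times_iff)
  have closed: "closedin (full_shift (A \<times> B)) (product_shift X Y)"
    unfolding eq using X Y
    by (intro closedin_Int closedin_continuous_map_preimage[OF continuous_map_full_shift_comp])
       (auto simp: subshift_def)
  have inv: "shift z \<in> product_shift X Y \<longleftrightarrow> z \<in> product_shift X Y" for z
    using subshift_shift_iff[OF X] subshift_shift_iff[OF Y]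
    by (simp add: product_shift_def comp_shift)
  have surj: "z = shift (\<lambda>m. z (m - 1))" for z :: "int \<Rightarrow> 'a \<times> 'b"
    by (simp add: shift_def)
  have "shift ` product_shift X Y = product_shift X Y"
  proof
    show "shift ` product_shift X Y \<subseteq> product_shift X Y" using inv by auto
    show "product_shift X Y \<subseteq> shift ` product_shift X Y"
      using inv surj by (metis image_eqI subsetI)
  qed
  then show ?thesis
    using X Y closed by (auto simp: subshift_def)
qed

end

theory Submission
  imports Defs
begin

text \<open>A bounded mistake function may be replaced by a constant \<open>M\<close>, because constants are
  sublinear; the property then says that \<open>w1\<close> can be placed in front of \<open>w2\<close> after at most \<open>M\<close>
  letters of \<open>w1\<close> are changed.

  For a product, a word over pairs belongs to the language exactly when its two coordinate words
  belong to the languages of the factors (\<open>language_product_shift_iff\<close>): the two points that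
  carry them can be translated independently.  So both coordinates are glued separately, and the
  mistakes add up.

  For a factor, compactness turns the factor map into a sliding block code with some radius \<open>r\<close>
  (\<open>factor_map_block_code\<close>).  To glue \<open>z1\<close> to \<open>z2\<close>, choose preimages of both and glue, in \<open>X\<close>, a
  word \<open>w1\<close> of length \<open>|z1|\<close> to a word \<open>w2\<close> that covers \<open>z2\<close> together with margins of width
  \<open>r\<close>.  The image of the glued word ends with \<open>z2\<close> exactly.  In front of it, a letter can differ
  from the one in \<open>z1\<close> only if its window of width \<open>2r + 1\<close> contains one of the at most \<open>M\<close> mistakes or
  reaches into \<open>w2\<close>; hence there are at most \<open>(2r + 1) M + 2r\<close> mistakes.\<close>

section \<open>Bounded mistakes\<close>

lemma language_appendD1:
  assumes "u @ v \<in> language X"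
  shows "u \<in> language X"
proof -
  obtain x m where "x \<in> X" and "\<forall>k<length (u @ v). (u @ v) ! k = x (m + int k)"
    using assms by (auto simp: language_def)
  then have "\<forall>k<length u. u ! k = x (m + int k)"
    by (metis length_append nth_append trans_less_add1)
  with \<open>x \<in> X\<close> show ?thesis by (auto simp: language_def)
qed

lemma bounded_left_almost_spec_iff:
  "bounded_left_almost_spec X \<longleftrightarrow>
     (\<exists>M. \<forall>w1\<in>language X. \<forall>w2\<in>language X. \<exists>w1'.
        length w1' = length w1 \<and> hamming_dist w1' w1 \<le> M \<and> w1' @ w2 \<in> language X)"
    (is "_ \<longleftrightarrow> ?R")
proof
  assume "bounded_left_almost_spec X"
  then obtain g where g: "left_almost_spec X g" and "bounded (range g)"
    by (auto simp: bounded_left_almost_spec_def)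
  then obtain b where b: "\<And>n. norm (g n) \<le> b"
    by (auto simp: bounded_iff)
  have nat_bound: "h \<le> nat \<lceil>b\<rceil>" if "real h \<le> g n" for h n
    using that b[of n] by (simp add: abs_le_iff) linarith
  show ?R
  proof (intro exI[of _ "nat \<lceil>b\<rceil>"] ballI)
    fix w1 w2 assume "w1 \<in> language X" "w2 \<in> language X"
    then obtain w1' where "length w1' = length w1"
      "real (hamming_dist w1' w1) \<le> g (length w1)" "w1' @ w2 \<in> language X"
      using g unfolding left_almost_spec_def by blast
    then show "\<exists>w1'. length w1' = length w1 \<and> hamming_dist w1' w1 \<le> nat \<lceil>b\<rceil> \<and>
        w1' @ w2 \<in> language X"
      using nat_bound by blast
  qed
next
  assume ?R
  then obtain M where M: "\<forall>w1\<in>language X. \<forall>w2\<in>language X. \<exists>w1'.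
        length w1' = length w1 \<and> hamming_dist w1' w1 \<le> M \<and> w1' @ w2 \<in> language X" by blast
  have "(\<lambda>n. real M / real n) \<longlonglongrightarrow> 0"
    by (rule lim_const_over_n)
  with M have "left_almost_spec X (\<lambda>_. real M)"
    unfolding left_almost_spec_def of_nat_le_iff by (blast intro: language_appendD1 of_nat_0_le_iff)
  then show "bounded_left_almost_spec X"
    by (auto simp: bounded_left_almost_spec_def)
qed

section \<open>Translations by integers\<close>

definition translate :: "int \<Rightarrow> (int \<Rightarrow> 'a) \<Rightarrow> int \<Rightarrow> 'a" where
  "translate m x = (\<lambda>i. x (i + m))"

lemma translate_0 [simp]: "translate 0 x = x"
  by (simp add: translate_def)

lemma shift_translate: "shift (translate m x) = translate (m + 1) x"
  by (simp add: shift_def translate_def ac_simps)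

lemma inj_shift: "inj shift"
proof (rule injI)
  fix x y :: "int \<Rightarrow> 'a"
  assume eq: "shift x = shift y"
  have "x m = y m" for m
    using fun_cong[OF eq, of "m - 1"] by (simp add: shift_def)
  then show "x = y" by auto
qed

lemma translate_mem:
  assumes "subshift A X" and "x \<in> X"
  shows "translate m x \<in> X"
proof (induction m rule: int_induct[of _ 0])
  case base
  then show ?case using assms by simp
next
  case (step1 m)
  then show ?case
    using subshift_shift_iff[OF assms(1), of "translate m x"] by (simp add: shift_translate)
next
  case (step2 m)
  then show ?case
    using subshift_shift_iff[OF assms(1), of "translate (m - 1) x"] by (simp add: shift_translate)
qed

lemma shift_equivariant_translate:
  assumes X: "subshift A X" and eqv: "\<forall>x\<in>X. \<phi> (shift x) = shift (\<phi> x)" and "x \<in> X"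
  shows "\<phi> (translate m x) = translate m (\<phi> x)"
proof (induction m rule: int_induct[of _ 0])
  case base
  then show ?case by simp
next
  case (step1 m)
  then show ?case
    using eqv translate_mem[OF X \<open>x \<in> X\<close>] by (metis shift_translate)
next
  case (step2 m)
  have "shift (\<phi> (translate (m - 1) x)) = \<phi> (translate m x)"
    using eqv translate_mem[OF X \<open>x \<in> X\<close>, of "m - 1"] shift_translate[of "m - 1" x]
    by (metis diff_add_cancel)
  also have "\<dots> = shift (translate (m - 1) (\<phi> x))"
    using step2 by (simp add: shift_translate)
  finally show ?case
    by (rule injD[OF inj_shift])
qed

section \<open>Products\<close>

lemma language_product_shift_iff:
  assumes X: "subshift A X" and Y: "subshift B Y"
  shows "w \<in> language (product_shift X Y) \<longleftrightarrow>
           map fst w \<in> language X \<and> map snd w \<in> language Y"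
proof
  assume "w \<in> language (product_shift X Y)"
  then obtain z m where z: "fst \<circ> z \<in> X" "snd \<circ> z \<in> Y"
    and w: "\<forall>k<length w. w ! k = z (m + int k)"
    by (auto simp: language_def product_shift_def)
  have "\<forall>k<length (map fst w). map fst w ! k = (fst \<circ> z) (m + int k)"
    and "\<forall>k<length (map snd w). map snd w ! k = (snd \<circ> z) (m + int k)"
    using w by auto
  with z show "map fst w \<in> language X \<and> map snd w \<in> language Y"
    unfolding language_def by blast
next
  assume "map fst w \<in> language X \<and> map snd w \<in> language Y"
  then obtain x m y n where x: "x \<in> X" "\<forall>k<length w. fst (w ! k) = x (m + int k)"
    and y: "y \<in> Y" "\<forall>k<length w. snd (w ! k) = y (n + int k)"
    by (auto simp: language_def)
  define z where "z = (\<lambda>i. (translate m x i, translate n y i))"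
  have "fst \<circ> z = translate m x" "snd \<circ> z = translate n y"
    by (auto simp: z_def)
  then have "z \<in> product_shift X Y"
    using translate_mem[OF X x(1)] translate_mem[OF Y y(1)] by (simp add: product_shift_def)
  moreover have "\<forall>k<length w. w ! k = z (0 + int k)"
    using x(2) y(2) by (auto simp: z_def translate_def prod_eq_iff ac_simps)
  ultimately show "w \<in> language (product_shift X Y)"
    unfolding language_def by blast
qed

lemma hamming_dist_zip_le:
  assumes "length u = length w" and "length v = length w"
  shows "hamming_dist (zip u v) w \<le> hamming_dist u (map fst w) + hamming_dist v (map snd w)"
proof -
  have "{i. i < length (zip u v) \<and> zip u v ! i \<noteq> w ! i} \<subseteq>
      {i. i < length u \<and> u ! i \<noteq> map fst w ! i} \<union> {i. i < length v \<and> v ! i \<noteq> map snd w ! i}"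
    using assms by (auto simp: prod_eq_iff)
  then show ?thesis
    unfolding hamming_dist_def by (intro order_trans[OF card_mono card_Un_le]) auto
qed

lemma bounded_left_almost_spec_product_shift:
  assumes X: "subshift A X" and Y: "subshift B Y"
    and bX: "bounded_left_almost_spec X" and bY: "bounded_left_almost_spec Y"
  shows "bounded_left_almost_spec (product_shift X Y)"
proof -
  note language_iff = language_product_shift_iff[OF X Y]
  obtain M where M: "\<forall>w1\<in>language X. \<forall>w2\<in>language X. \<exists>w1'.
      length w1' = length w1 \<and> hamming_dist w1' w1 \<le> M \<and> w1' @ w2 \<in> language X"
    using bX unfolding bounded_left_almost_spec_iff by blast
  obtain N where N: "\<forall>w1\<in>language Y. \<forall>w2\<in>language Y. \<exists>w1'.
      length w1' = length w1 \<and> hamming_dist w1' w1 \<le> N \<and> w1' @ w2 \<in> language Y"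
    using bY unfolding bounded_left_almost_spec_iff by blast
  show ?thesis
    unfolding bounded_left_almost_spec_iff
  proof (intro exI[of _ "M + N"] ballI)
    fix w1 w2
    assume "w1 \<in> language (product_shift X Y)" "w2 \<in> language (product_shift X Y)"
    then have w: "map fst w1 \<in> language X" "map snd w1 \<in> language Y"
        "map fst w2 \<in> language X" "map snd w2 \<in> language Y"
      by (auto simp: language_iff)
    obtain u where u: "length u = length w1" "hamming_dist u (map fst w1) \<le> M"
        "u @ map fst w2 \<in> language X"
      using M w by (metis length_map)
    obtain v where v: "length v = length w1" "hamming_dist v (map snd w1) \<le> N"
        "v @ map snd w2 \<in> language Y"
      using N w by (metis length_map)
    have "zip u v @ w2 \<in> language (product_shift X Y)"
      using u v by (simp add: language_iff)
    moreover have "hamming_dist (zip u v) w1 \<le> M + N"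
      using hamming_dist_zip_le[OF u(1) v(1)] u(2) v(2) by linarith
    moreover have "length (zip u v) = length w1"
      using u v by simp
    ultimately show "\<exists>w1'. length w1' = length w1 \<and> hamming_dist w1' w1 \<le> M + N \<and>
        w1' @ w2 \<in> language (product_shift X Y)"
      by blast
  qed
qed

section \<open>Factors\<close>

lemma compactin_subshift:
  assumes "subshift A X"
  shows "compactin (full_shift A) X"
proof -
  have "compact_space (full_shift A)"
    using assms by (auto simp: full_shift_def compact_space_product_topology
        compact_space_discrete_topology subshift_def)
  with assms show ?thesis
    by (auto simp: subshift_def intro: closedin_compact_space)
qed

lemma openin_full_shift_cylinder:
  assumes "openin (full_shift A) U" and "x \<in> U"
  shows "\<exists>r. \<forall>y\<in>topspace (full_shift A). (\<forall>i. \<bar>i\<bar> \<le> int r \<longrightarrow> y i = x i) \<longrightarrow> y \<in> U"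
proof -
  obtain V where V: "finite {i. V i \<noteq> A}" "x \<in> Pi\<^sub>E UNIV V" "Pi\<^sub>E UNIV V \<subseteq> U"
    using assms unfolding full_shift_def openin_product_topology_alt by force
  obtain r where r: "\<forall>i\<in>{i. V i \<noteq> A}. nat \<bar>i\<bar> \<le> r"
    using finite_nat_set_iff_bounded_le[of "(\<lambda>i. nat \<bar>i\<bar>) ` {i. V i \<noteq> A}"] V(1) by auto
  have "y \<in> U" if y: "y \<in> topspace (full_shift A)" "\<forall>i. \<bar>i\<bar> \<le> int r \<longrightarrow> y i = x i" for y
  proof -
    have "y i \<in> V i" for i
    proof (cases "V i = A")
      case True
      then show ?thesis using y(1) by (auto simp: full_shift_def PiE_iff)
    next
      case False
      then have "y i = x i" using r y(2) by (simp add: nat_le_iff)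
      then show ?thesis using V(2) by (auto simp: PiE_iff)
    qed
    then show ?thesis using V(3) by auto
  qed
  then show ?thesis by blast
qed

lemma openin_cylinder:
  assumes "finite I" and "x \<in> topspace (full_shift A)"
  shows "openin (full_shift A) {y \<in> topspace (full_shift A). \<forall>i\<in>I. y i = x i}"
proof -
  have "{y \<in> topspace (full_shift A). \<forall>i\<in>I. y i = x i} =
      Pi\<^sub>E UNIV (\<lambda>i. if i \<in> I then {x i} else A)"
  proof (rule set_eqI)
    fix y
    have "x i \<in> A" for i using assms(2) by (auto simp: full_shift_def PiE_iff)
    then have "(\<forall>i. y i \<in> A) \<and> (\<forall>i\<in>I. y i = x i) \<longleftrightarrow>
        (\<forall>i. y i \<in> (if i \<in> I then {x i} else A))"
      by (metis singleton_iff)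
    then show "y \<in> {y \<in> topspace (full_shift A). \<forall>i\<in>I. y i = x i} \<longleftrightarrow>
        y \<in> Pi\<^sub>E UNIV (\<lambda>i. if i \<in> I then {x i} else A)"
      by (simp only: full_shift_def topspace_product_topology topspace_discrete_topology
          PiE_UNIV_domain Pi_iff mem_Collect_eq UNIV_I o_def simp_thms ball_UNIV)
  qed
  moreover have "openin (full_shift A) (Pi\<^sub>E UNIV (\<lambda>i. if i \<in> I then {x i} else A))"
    unfolding full_shift_def using assms
    by (intro product_topology_basis) (auto simp: full_shift_def PiE_iff)
  ultimately show ?thesis by simp
qed

text \<open>Continuity gives, around each point \<open>x\<close>, a radius \<open>\<rho> x\<close> on which the zeroth letter of the
  image depends; finitely many of the corresponding cylinders cover \<open>X\<close>, and the largest of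
  their radii works everywhere.\<close>

lemma continuous_map_zeroth_letter:
  assumes X: "subshift A X"
    and cont: "continuous_map (subtopology (full_shift A) X) (full_shift B) \<phi>"
  shows "\<exists>r. \<forall>x\<in>X. \<forall>y\<in>X. (\<forall>i. \<bar>i\<bar> \<le> int r \<longrightarrow> y i = x i) \<longrightarrow> \<phi> y 0 = \<phi> x 0"
proof -
  have XA: "X \<subseteq> topspace (full_shift A)"
    using X by (auto simp: subshift_def dest: closedin_subset)
  have cont0: "continuous_map (subtopology (full_shift A) X) (discrete_topology B) (\<lambda>x. \<phi> x 0)"
    using cont unfolding full_shift_def[of B] continuous_map_componentwise_UNIV by blast
  have "\<exists>r. \<forall>y\<in>X. (\<forall>i. \<bar>i\<bar> \<le> int r \<longrightarrow> y i = x i) \<longrightarrow> \<phi> y 0 = \<phi> x 0" if x: "x \<in> X" for x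
  proof -
    have "x \<in> topspace (subtopology (full_shift A) X)"
      using x XA by auto
    then have "\<phi> x 0 \<in> B"
      using cont0 by (auto simp: continuous_map_def)
    then have "openin (subtopology (full_shift A) X)
        {y \<in> topspace (subtopology (full_shift A) X). \<phi> y 0 \<in> {\<phi> x 0}}"
      by (intro openin_continuous_map_preimage[OF cont0]) simp
    then obtain U where U: "openin (full_shift A) U"
        "{y \<in> topspace (subtopology (full_shift A) X). \<phi> y 0 \<in> {\<phi> x 0}} = U \<inter> X"
      unfolding openin_subtopology by metis
    then have "x \<in> U" using x XA by auto
    then obtain r where "\<forall>y\<in>topspace (full_shift A). (\<forall>i. \<bar>i\<bar> \<le> int r \<longrightarrow> y i = x i) \<longrightarrow> y \<in> U"
      using openin_full_shift_cylinder[OF U(1)] by blast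
    then have "\<forall>y\<in>X. (\<forall>i. \<bar>i\<bar> \<le> int r \<longrightarrow> y i = x i) \<longrightarrow> \<phi> y 0 = \<phi> x 0"
      using U(2) XA by blast
    then show ?thesis by blast
  qed
  then obtain \<rho> where \<rho>: "\<And>x y. x \<in> X \<Longrightarrow> y \<in> X \<Longrightarrow>
      \<forall>i. \<bar>i\<bar> \<le> int (\<rho> x) \<longrightarrow> y i = x i \<Longrightarrow> \<phi> y 0 = \<phi> x 0"
    by metis
  define C where "C x = {y \<in> topspace (full_shift A). \<forall>i\<in>{- int (\<rho> x)..int (\<rho> x)}. y i = x i}" for x
  have "\<forall>U\<in>C ` X. openin (full_shift A) U"
    unfolding C_def using XA by (auto intro!: openin_cylinder)
  moreover have "X \<subseteq> \<Union>(C ` X)"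
    using XA by (auto simp: C_def)
  ultimately obtain \<F> where "finite \<F>" "\<F> \<subseteq> C ` X" "X \<subseteq> \<Union>\<F>"
    using compactin_subshift[OF X] unfolding compactin_def by meson
  then obtain F where F: "finite F" "F \<subseteq> X" "X \<subseteq> \<Union>(C ` F)"
    by (metis finite_subset_image)
  obtain r where r: "\<forall>x\<in>F. \<rho> x \<le> r"
    using finite_nat_set_iff_bounded_le[of "\<rho> ` F"] F(1) by auto
  have "\<phi> y 0 = \<phi> x 0" if xy: "x \<in> X" "y \<in> X" "\<forall>i. \<bar>i\<bar> \<le> int r \<longrightarrow> y i = x i" for x y
  proof -
    obtain c where c: "c \<in> F" "x \<in> C c"
      using F xy by auto
    have xc: "x i = c i" if "\<bar>i\<bar> \<le> int (\<rho> c)" for i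
      using c(2) that by (simp add: C_def abs_le_iff)
    have "y i = c i" if "\<bar>i\<bar> \<le> int (\<rho> c)" for i
      using xc[OF that] xy(3) r c(1) that by fastforce
    then have "\<phi> y 0 = \<phi> c 0" "\<phi> x 0 = \<phi> c 0"
      using \<rho> c F xy xc by blast+
    then show ?thesis by simp
  qed
  then show ?thesis by blast
qed

text \<open>The forward half of the Curtis--Hedlund--Lyndon theorem: equivariance carries the dependence of the
  zeroth letter to all positions.  The windows are indexed by natural numbers, from their left
  ends, to match the positions in a word.\<close>

lemma factor_map_block_code:
  assumes X: "subshift A X"
    and cont: "continuous_map (subtopology (full_shift A) X) (full_shift B) \<phi>"
    and eqv: "\<forall>x\<in>X. \<phi> (shift x) = shift (\<phi> x)"
  obtains r where "\<And>x y m n. x \<in> X \<Longrightarrow> y \<in> X \<Longrightarrow>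
    (\<And>k. k \<le> 2 * r \<Longrightarrow> x (m + int k) = y (n + int k)) \<Longrightarrow> \<phi> x (m + int r) = \<phi> y (n + int r)"
proof -
  obtain r where r: "\<forall>x\<in>X. \<forall>y\<in>X. (\<forall>i. \<bar>i\<bar> \<le> int r \<longrightarrow> y i = x i) \<longrightarrow> \<phi> y 0 = \<phi> x 0"
    using continuous_map_zeroth_letter[OF X cont] by blast
  have "\<phi> x (m + int r) = \<phi> y (n + int r)"
    if xy: "x \<in> X" "y \<in> X" and eq: "\<And>k. k \<le> 2 * r \<Longrightarrow> x (m + int k) = y (n + int k)" for x y m n
  proof -
    have "translate (m + int r) x i = translate (n + int r) y i" if "\<bar>i\<bar> \<le> int r" for i
    proof -
      have "nat (i + int r) \<le> 2 * r" "int (nat (i + int r)) = i + int r"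
        using that by linarith+
      then have "x (m + (i + int r)) = y (n + (i + int r))"
        using eq by metis
      then show ?thesis by (simp add: translate_def ac_simps)
    qed
    then have "\<phi> (translate (m + int r) x) 0 = \<phi> (translate (n + int r) y) 0"
      using r translate_mem[OF X] xy by blast
    then show ?thesis
      using shift_equivariant_translate[OF X eqv] xy by (simp add: translate_def)
  qed
  then show thesis using that by blast
qed

text \<open>An image letter is determined by a window of \<open>d + 1\<close> letters (below, \<open>d = 2r\<close>), so a
  mistake in the image comes from a mistake in its window or from the window leaving the word.
  The latter accounts for the last \<open>d\<close> positions, and each mistake in \<open>v\<close> lies in at most \<open>d + 1\<close>
  windows.\<close>

lemma hamming_dist_block_image_le:
  assumes len: "length v' = length v"
    and local: "\<And>i. i + d < length v \<Longrightarrow> (\<And>k. k \<le> d \<Longrightarrow> v ! (i + k) = w ! (i + k)) \<Longrightarrow> v' ! i = w' ! i"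
  shows "hamming_dist v' w' \<le> (d + 1) * hamming_dist v w + d"
proof -
  let ?D = "{j. j < length v \<and> v ! j \<noteq> w ! j}"
  have "{i. i < length v' \<and> v' ! i \<noteq> w' ! i} \<subseteq>
      (\<lambda>(k, j). j - k) ` ({..d} \<times> ?D) \<union> {length v - d..<length v}" (is "?L \<subseteq> ?E \<union> ?T")
  proof
    fix i assume i: "i \<in> ?L"
    show "i \<in> ?E \<union> ?T"
    proof (cases "i + d < length v")
      case True
      then obtain k where "k \<le> d" "v ! (i + k) \<noteq> w ! (i + k)"
        using i local by blast
      then have "(k, i + k) \<in> {..d} \<times> ?D" "i = (\<lambda>(k, j). j - k) (k, i + k)"
        using True by auto
      then show ?thesis by blast
    next
      case False
      then show ?thesis using i len by auto
    qed
  qed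
  then have "card ?L \<le> card (?E \<union> ?T)"
    by (intro card_mono) auto
  also have "\<dots> \<le> card ?E + card ?T"
    by (rule card_Un_le)
  also have "\<dots> \<le> (d + 1) * card ?D + d"
  proof (rule add_mono)
    have "card ?E \<le> card ({..d} \<times> ?D)"
      by (intro card_image_le) auto
    then show "card ?E \<le> (d + 1) * card ?D"
      by (simp add: card_cartesian_product)
  qed simp
  finally show ?thesis
    by (simp add: hamming_dist_def)
qed

lemma bounded_left_almost_spec_factor:
  assumes X: "subshift A X" and bX: "bounded_left_almost_spec X"
    and Z: "symbolic_factor A X B Z"
  shows "bounded_left_almost_spec Z"
proof -
  obtain \<phi> where "continuous_map (subtopology (full_shift A) X) (subtopology (full_shift B) Z) \<phi>"
    and im: "\<phi> ` X = Z" and eqv: "\<forall>x\<in>X. \<phi> (shift x) = shift (\<phi> x)"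
    using Z by (auto simp: symbolic_factor_def)
  then have cont: "continuous_map (subtopology (full_shift A) X) (full_shift B) \<phi>"
    by (simp add: continuous_map_in_subtopology)
  obtain r where r: "\<And>x y m n. x \<in> X \<Longrightarrow> y \<in> X \<Longrightarrow>
    (\<And>k. k \<le> 2 * r \<Longrightarrow> x (m + int k) = y (n + int k)) \<Longrightarrow> \<phi> x (m + int r) = \<phi> y (n + int r)"
    using factor_map_block_code[OF X cont eqv] by blast
  obtain M where M: "\<forall>w1\<in>language X. \<forall>w2\<in>language X. \<exists>w1'.
      length w1' = length w1 \<and> hamming_dist w1' w1 \<le> M \<and> w1' @ w2 \<in> language X"
    using bX unfolding bounded_left_almost_spec_iff by blast
  have factor_word: "\<exists>x\<in>X. \<exists>m. \<forall>k<length z. z ! k = \<phi> x (m + int k + int r)"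
    if z: "z \<in> language Z" for z
  proof -
    obtain x m where "x \<in> X" and "\<forall>k<length z. z ! k = \<phi> x (m + int k)"
      using z im by (auto simp: language_def)
    then show ?thesis
      by (intro bexI[of _ x] exI[of _ "m - int r"]) (simp_all add: algebra_simps)
  qed
  show ?thesis
    unfolding bounded_left_almost_spec_iff
  proof (intro exI[of _ "(2 * r + 1) * M + 2 * r"] ballI)
    fix z1 z2 assume "z1 \<in> language Z" "z2 \<in> language Z"
    then obtain x m y n where x: "x \<in> X" "\<forall>k<length z1. z1 ! k = \<phi> x (m + int k + int r)"
      and y: "y \<in> X" "\<forall>k<length z2. z2 ! k = \<phi> y (n + int k + int r)"
      using factor_word by metis
    let ?l = "length z1"
    \<comment> \<open>Only \<open>w2\<close> gets the margins: the glued word then has exactly \<open>2r\<close> letters more than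
      \<open>z1 @ z2\<close>, as needed for its image to have the right length.\<close>
    define w1 where "w1 = map (\<lambda>k. x (m + int k)) [0..<?l]"
    define w2 where "w2 = map (\<lambda>k. y (n + int k)) [0..<length z2 + 2 * r]"
    have "w1 \<in> language X" "w2 \<in> language X"
      using x(1) y(1) by (force simp: language_def w1_def w2_def)+
    then obtain v where v: "length v = ?l" "hamming_dist v w1 \<le> M" "v @ w2 \<in> language X"
      using M by (metis diff_zero length_map length_upt w1_def)
    then obtain u q where u: "u \<in> X" "\<forall>k<?l + length w2. (v @ w2) ! k = u (q + int k)"
      by (auto simp: language_def)
    have uv: "u (q + int k) = v ! k" if "k < ?l" for k
      using u(2)[rule_format, of k] that v(1) by (simp add: nth_append)
    have uy: "u (q + int (?l + k)) = y (n + int k)" if "k < length z2 + 2 * r" for k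
      using u(2)[rule_format, of "?l + k"] that v(1) by (simp add: w2_def nth_append)
    define z1' where "z1' = map (\<lambda>k. \<phi> u (q + int k + int r)) [0..<?l]"
    have "hamming_dist z1' z1 \<le> (2 * r + 1) * hamming_dist v w1 + 2 * r"
    proof (rule hamming_dist_block_image_le)
      show "length z1' = length v" by (simp add: z1'_def v(1))
      fix i assume i: "i + 2 * r < length v"
        and eq: "\<And>k. k \<le> 2 * r \<Longrightarrow> v ! (i + k) = w1 ! (i + k)"
      have "\<phi> u ((q + int i) + int r) = \<phi> x ((m + int i) + int r)"
      proof (rule r[OF u(1) x(1)])
        fix k assume "k \<le> 2 * r"
        then show "u (q + int i + int k) = x (m + int i + int k)"
          using uv[of "i + k"] eq[of k] i v(1) by (simp add: w1_def ac_simps)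
      qed
      then show "z1' ! i = z1 ! i"
        using i v(1) x(2) by (simp add: z1'_def)
    qed
    also have "\<dots> \<le> (2 * r + 1) * M + 2 * r"
      using v(2) by (intro add_mono mult_mono) auto
    finally have dist: "hamming_dist z1' z1 \<le> (2 * r + 1) * M + 2 * r" .
    have z2: "z2 ! k = \<phi> u (q + int (?l + k) + int r)" if k: "k < length z2" for k
    proof -
      have "\<phi> u (q + int (?l + k) + int r) = \<phi> y (n + int k + int r)"
      proof (rule r[OF u(1) y(1)])
        fix j assume "j \<le> 2 * r"
        then show "u (q + int (?l + k) + int j) = y (n + int k + int j)"
          using uy[of "k + j"] k by (simp add: ac_simps)
      qed
      then show ?thesis using y(2) k by simp
    qed
    have "(z1' @ z2) ! k = \<phi> u (q + int r + int k)" if "k < length (z1' @ z2)" for k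
    proof (cases "k < ?l")
      case True
      then show ?thesis by (simp add: z1'_def nth_append ac_simps)
    next
      case False
      then show ?thesis
        using z2[of "k - ?l"] that by (simp add: z1'_def nth_append ac_simps)
    qed
    moreover have "\<phi> u \<in> Z" using u(1) im by blast
    ultimately have "z1' @ z2 \<in> language Z"
      unfolding language_def by blast
    moreover have "length z1' = length z1"
      by (simp add: z1'_def)
    ultimately show "\<exists>z1'. length z1' = length z1 \<and>
        hamming_dist z1' z1 \<le> (2 * r + 1) * M + 2 * r \<and> z1' @ z2 \<in> language Z"
      using dist by blast
  qed
qed

theorem proposition1p7:
  shows "(\<forall>(A :: 'a set) X (B :: 'b set) Y.
            subshift A X \<and> subshift B Y \<and>
            bounded_left_almost_spec X \<and> bounded_left_almost_spec Y \<longrightarrow>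
            bounded_left_almost_spec (product_shift X Y)) \<and>
         (\<forall>(A :: 'c set) X (B :: 'd set) Z.
            subshift A X \<and> bounded_left_almost_spec X \<and> symbolic_factor A X B Z \<longrightarrow>
            bounded_left_almost_spec Z)"
  using bounded_left_almost_spec_product_shift bounded_left_almost_spec_factor by blast

end
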